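(* The generalized elementary symmetric functions $e^{(p)}_a$ satisfy the following Newton's identity: for all $a,b\in\mathbb Z$, $$\sum_{p=-\infty}^{\infty}(-1)^{a-p}\,h^{(p)}_b\,e^{(-p)}_a=\delta_{a,b}.$$
   Context: Setting. Let $B=\mathbb C[h^{(0)}_1,h^{(0)}_2,\dots]$ be the polynomial ring in independent variables $h^{(0)}_k$ ($k>0$), with $h^{(0)}_0=1$ and $h^{(0)}_k=0$ for $k<0$. $B$ is graded by $\deg h^{(0)}_n=n$, and $B^{\le n}$ is the sum of the homogeneous components of degree $\le n$. Let $\{h^{(r)}_k\}_{k,r\in\mathbb Z}$ be a family of elements of $B$ (extending the $h^{(0)}_k$) with $h^{(r)}_k\in B^{\le k+r}$, $h^{(k)}_{-k}=1$ for all $k\in\mathbb Z$, and $h^{(r)}_k=0$ whenever $k+r<0$. It is also required that the polynomials $s_\lambda=\det[h^{(j-1)}_{\lambda_i-i+1}]_{1\le i,j\le l}$, over all partitions $\lambda=(\lambda_1\ge\dots\ge\lambda_l\ge0)$, form a linear basis of $B$. Generalized elementary symmetric functions: for $a,p\in\mathbb Z$, $e^{(p)}_a=0$ if $p<a$, $e^{(p)}_a=1$ if $p=a$, and $e^{(p)}_a=\det\left[h^{(-p+j)}_{p+1-i}\right]_{1\le i,j\le p-a}$ if $p>a$. The sum in the claim has only finitely many nonzero terms (those with $-b\le p\le -a$). *)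

theory Defs
  imports "HOL-Library.Poly_Mapping" "Jordan_Normal_Form.Determinant"
begin

text \<open>
  \<open>B\<close> is the polynomial ring over the complex numbers in countably many variables; a monomial is
  its exponent vector. The variables \<open>h\<^sup>(\<^sup>0\<^sup>)\<^sub>n\<close> have positive index, so exponent position \<open>i\<close>
  belongs to \<open>h\<^sup>(\<^sup>0\<^sup>)\<close> with lower index \<open>i + 1\<close>.
\<close>

type_synonym monomial = "nat \<Rightarrow>\<^sub>0 nat"
type_synonym B = "monomial \<Rightarrow>\<^sub>0 complex"

definition h0 :: "int \<Rightarrow> B" where
  "h0 k = (if k < 0 then 0 else if k = 0 then 1
           else Poly_Mapping.single (Poly_Mapping.single (nat k - 1) 1) 1)"

definition scale :: "complex \<Rightarrow> B \<Rightarrow> B" where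
  "scale c f = Poly_Mapping.single 0 c * f"

global_interpretation B: vector_space scale
  defines B_span = B.span and B_independent = B.independent
proof
qed (simp_all add: scale_def algebra_simps single_add mult_single flip: mult.assoc)

definition wdeg :: "monomial \<Rightarrow> nat" where
  "wdeg m = (\<Sum>i\<in>Poly_Mapping.keys m. (i + 1) * Poly_Mapping.lookup m i)"

definition B_homogeneous :: "nat \<Rightarrow> B set" where
  "B_homogeneous d = {f. \<forall>m\<in>Poly_Mapping.keys f. wdeg m = d}"

text \<open>The bound is an integer; for a negative bound the sum of components is empty and only \<open>0\<close>
  remains.\<close>

definition B_le :: "int \<Rightarrow> B set" where
  "B_le n = B_span (\<Union>d\<in>{d. int d \<le> n}. B_homogeneous d)"

text \<open>In \<open>h r k\<close> the first argument is the upper index \<open>r\<close>, the second the lower index \<open>k\<close>; likewise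
  \<open>e h p a\<close> has upper index \<open>p\<close>. Matrix indices start at \<open>0\<close>, hence the shifts by one with respect to
  the usual 1-based formulas, which are
  \<open>det [h (j - 1) (\<lambda>\<^sub>i - i + 1)]\<close> and \<open>det [h (- p + j) (p + 1 - i)]\<close>.\<close>

definition s :: "(int \<Rightarrow> int \<Rightarrow> B) \<Rightarrow> nat list \<Rightarrow> B" where
  "s h xs = det (mat (length xs) (length xs) (\<lambda>(i, j). h (int j) (int (xs ! i) - int i)))"

definition e :: "(int \<Rightarrow> int \<Rightarrow> B) \<Rightarrow> int \<Rightarrow> int \<Rightarrow> B" where
  "e h p a = (if p < a then 0 else if p = a then 1
              else det (mat (nat (p - a)) (nat (p - a)) (\<lambda>(i, j). h (- p + int j + 1) (p - int i))))"

text \<open>Partitions that differ by trailing zeros are the same partition; the representative without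
  zero parts is used. By \<open>s_trailing_zero\<close> below, \<open>s\<close> does not depend on this choice.\<close>

definition partitions :: "nat list set" where
  "partitions = {xs. sorted_wrt (\<ge>) xs \<and> 0 \<notin> set xs}"

definition linear_basis :: "('i \<Rightarrow> B) \<Rightarrow> 'i set \<Rightarrow> bool" where
  "linear_basis v I \<longleftrightarrow> inj_on v I \<and> B_independent (v ` I) \<and> B_span (v ` I) = UNIV"

lemma s_trailing_zero:
  assumes one: "\<And>k. h k (- k) = 1" and zero: "\<And>r k. k + r < 0 \<Longrightarrow> h r k = 0"
  shows "s h (xs @ [0]) = s h xs"
proof -
  define l where "l = length xs"
  define A where
    "A = mat (Suc l) (Suc l) (\<lambda>(i, j). h (int j) (int ((xs @ [0]) ! i) - int i))"
  have A: "A \<in> carrier_mat (Suc l) (Suc l)"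
    by (simp add: A_def)
  have entry: "A $$ (l, j) = (if j = l then 1 else 0)" if "j < Suc l" for j
    using that one[of "int l"] by (auto simp: A_def l_def nth_append intro!: zero)
  have "det A = (\<Sum>j<Suc l. A $$ (l, j) * cofactor A l j)"
    by (rule laplace_expansion_row[OF A]) simp
  also have "\<dots> = (\<Sum>j<Suc l. if j = l then cofactor A l j else 0)"
    by (rule sum.cong) (auto simp: entry)
  also have "\<dots> = det (mat_delete A l l)"
    by (simp add: cofactor_def)
  also have "mat_delete A l l = mat l l (\<lambda>(i, j). h (int j) (int (xs ! i) - int i))"
    by (rule eq_matI) (auto simp: A_def l_def mat_delete_def nth_append)
  finally show ?thesis
    by (simp add: s_def A_def l_def)
qed

text \<open>\<open>Sum_any\<close> is \<open>0\<close> on families with infinite support; this does not happen here.\<close>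

lemma newton_finite_support:
  assumes zero: "\<And>r k. k + r < 0 \<Longrightarrow> h r k = 0"
  shows "finite {p. (- 1) ^ nat \<bar>a - p\<bar> * h p b * e h (- p) a \<noteq> 0}"
proof (rule finite_subset)
  show "{p. (- 1) ^ nat \<bar>a - p\<bar> * h p b * e h (- p) a \<noteq> 0} \<subseteq> {- b..- a}"
  proof
    fix p
    assume "p \<in> {p. (- 1) ^ nat \<bar>a - p\<bar> * h p b * e h (- p) a \<noteq> 0}"
    then have "h p b \<noteq> 0" and "e h (- p) a \<noteq> 0"
      by auto
    then have "\<not> b + p < 0" and "\<not> - p < a"
      using zero[of b p] by (auto simp: e_def)
    then show "p \<in> {- b..- a}"
      by simp
  qed
qed simp

end

theory Submission
  imports Defs
begin

text \<open>The matrix of \<open>e h b a\<close> has ones on the subdiagonal and zeros below it. Deleting its first row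
  and the column with upper index \<open>- q\<close> leaves a block upper triangular matrix: a unitriangular
  block followed by the matrix of \<open>e h q a\<close>. Laplace expansion along the first row is therefore
  Newton's identity solved for its term \<open>p = - b\<close>.\<close>

text \<open>The first column is a unit vector, so expanding along it leaves a single minor of the
  same shape with \<open>k\<close> lowered by one. Entries above the diagonal may be
  arbitrary.\<close>

lemma det_unitriangular_prefix:
  fixes f :: "nat \<Rightarrow> nat \<Rightarrow> 'a :: comm_ring_1"
  assumes "\<And>i j. j < k \<Longrightarrow> j \<le> i \<Longrightarrow> i < k + m \<Longrightarrow> f i j = (if i = j then 1 else 0)"
  shows "det (mat (k + m) (k + m) (\<lambda>(i, j). f i j)) = det (mat m m (\<lambda>(i, j). f (i + k) (j + k)))"
  using assms
proof (induction k arbitrary: f)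
  case 0
  then show ?case by simp
next
  case (Suc k)
  define n where "n = k + m"
  define A where "A = mat (Suc n) (Suc n) (\<lambda>(i, j). f i j)"
  have A: "A \<in> carrier_mat (Suc n) (Suc n)"
    by (simp add: A_def)
  have "det A = (\<Sum>i<Suc n. A $$ (i, 0) * cofactor A i 0)"
    by (rule laplace_expansion_column[OF A]) simp
  also have "\<dots> = (\<Sum>i<Suc n. if i = 0 then cofactor A 0 0 else 0)"
    by (rule sum.cong) (auto simp: A_def n_def Suc.prems)
  also have "\<dots> = det (mat_delete A 0 0)"
    by (simp add: cofactor_def)
  also have "mat_delete A 0 0 = mat n n (\<lambda>(i, j). f (Suc i) (Suc j))"
    by (rule eq_matI) (auto simp: A_def mat_delete_def)
  also have "det \<dots> = det (mat m m (\<lambda>(i, j). f (Suc (i + k)) (Suc (j + k))))"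
    unfolding n_def by (rule Suc.IH) (auto simp: Suc.prems)
  finally show ?case
    by (simp add: A_def n_def)
qed

lemma e_first_row_expansion:
  assumes one: "\<And>k. h k (- k) = 1" and zero: "\<And>r k. k + r < 0 \<Longrightarrow> h r k = 0"
    and "a < b"
  shows "e h b a = (\<Sum>j<nat (b - a). (- 1) ^ j * h (1 - b + int j) b * e h (b - 1 - int j) a)"
proof -
  define n where "n = nat (b - a)"
  define f where "f = (\<lambda>i j. h (1 - b + int j) (b - int i))"
  \<comment> \<open>The upper and lower index of the entry in row \<open>Suc i\<close> and column
    \<open>j\<close> add up to \<open>j - i\<close>, so \<open>one\<close> applies on the
    subdiagonal and \<open>zero\<close> below it.\<close>
  have f_eq: "f (Suc i) j = (if i = j then 1 else 0)" if "j \<le> i" for i j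
    using that one[of "1 - b + int j"] by (auto simp: f_def algebra_simps intro!: zero)
  define A where "A = mat n n (\<lambda>(i, j). f i j)"
  have A: "A \<in> carrier_mat n n"
    by (simp add: A_def)
  have minor: "det (mat_delete A 0 j) = e h (b - 1 - int j) a" if "j < n" for j
  proof -
    define m where "m = n - 1 - j"
    \<comment> \<open>Columns left of the deleted one keep their place while all rows move up, which
      puts the subdiagonal ones of \<open>f\<close> on the diagonal of \<open>g\<close>.\<close>
    define g where "g = (\<lambda>i l. f (Suc i) (if l < j then l else Suc l))"
    have n: "n - 1 = j + m" and m: "m = nat (b - 1 - int j - a)"
      using that by (auto simp: m_def n_def)
    have "mat_delete A 0 j = mat (j + m) (j + m) (\<lambda>(i, l). g i l)"
      using that n by (intro eq_matI) (auto simp: A_def mat_delete_def g_def)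
    also have "det \<dots> = det (mat m m (\<lambda>(i, l). g (i + j) (l + j)))"
      by (rule det_unitriangular_prefix) (auto simp: g_def f_eq)
    also have "mat m m (\<lambda>(i, l). g (i + j) (l + j))
        = mat m m (\<lambda>(i, l). h (- (b - 1 - int j) + int l + 1) (b - 1 - int j - int i))"
      by (rule eq_matI) (auto simp: g_def f_def algebra_simps)
    \<comment> \<open>For \<open>j = n - 1\<close> the block is empty; its determinant 1 agrees with
      the value of \<open>e\<close> at equal indices.\<close>
    also have "det \<dots> = e h (b - 1 - int j) a"
      using that by (auto simp: e_def m n_def)
    finally show ?thesis .
  qed
  have entry: "A $$ (0, j) = h (1 - b + int j) b" if "j < n" for j
    using that by (simp add: A_def f_def)
  have "e h b a = det A"
    using \<open>a < b\<close> by (simp add: e_def A_def f_def n_def algebra_simps)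
  also have "\<dots> = (\<Sum>j<n. A $$ (0, j) * cofactor A 0 j)"
    by (rule laplace_expansion_row[OF A]) (use \<open>a < b\<close> in \<open>simp add: n_def\<close>)
  also have "\<dots> = (\<Sum>j<n. (- 1) ^ j * h (1 - b + int j) b * e h (b - 1 - int j) a)"
    by (rule sum.cong) (auto simp: cofactor_def minor entry mult_ac)
  finally show ?thesis
    by (simp add: n_def)
qed

theorem proposition3p1:
  fixes h :: "int \<Rightarrow> int \<Rightarrow> B" and a b :: int
  assumes h_extends: "\<And>k. h 0 k = h0 k"
    and h_degree: "\<And>r k. h r k \<in> B_le (k + r)"
    and h_one: "\<And>k. h k (- k) = 1"
    and h_zero: "\<And>r k. k + r < 0 \<Longrightarrow> h r k = 0"
    and s_basis: "linear_basis (s h) partitions"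
  shows "Sum_any (\<lambda>p. (- 1) ^ nat \<bar>a - p\<bar> * h p b * e h (- p) a) = (if a = b then 1 else 0)"
proof -
  define t where "t = (\<lambda>p. (- 1) ^ nat \<bar>a - p\<bar> * h p b * e h (- p) a)"
  have t_zero: "t p = 0" if "p \<notin> {- b..- a}" for p
    using that h_zero[of b p] by (auto simp: t_def e_def)
  have "Sum_any t = sum t {- b..- a}"
    by (rule Sum_any.expand_superset) (use t_zero in blast)+
  also have "\<dots> = (if a = b then 1 else 0)"
  proof (cases "a < b")
    \<comment> \<open>For \<open>a > b\<close> the interval is empty. For \<open>a = b\<close> only
      \<open>p = - a\<close> remains, with an even exponent in the sign and both factors equal to
      1.\<close>
    case False
    then show ?thesis
      using h_one[of "- a"]
      by (cases "a = b") (auto simp: t_def e_def simp flip: mult_2)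
  next
    case True
    define n where "n = nat (b - a)"
    have b: "b = a + int n"
      using True by (simp add: n_def)
    \<comment> \<open>With \<open>p = 1 - b + j\<close> the difference \<open>a - p\<close> is
      \<open>a + b - 1 - j\<close>; the absolute value does not change its parity, and the shift by
      one gives the minus sign.\<close>
    have sign: "(- 1 :: B) ^ nat \<bar>a - (1 - b + int j)\<bar> = - ((- 1) ^ nat \<bar>a + b\<bar> * (- 1) ^ j)" for j
    proof -
      have "even (nat \<bar>a - (1 - b + int j)\<bar>) \<longleftrightarrow> odd (nat \<bar>a + b\<bar> + j)"
        by (auto simp: even_nat_iff)
      then show ?thesis
        by (auto simp: minus_one_power_iff)
    qed
    \<comment> \<open>The term \<open>p = - b\<close> has the factor \<open>h (- b) b = 1\<close>,
      so it is \<open>e h b a\<close> up to sign; the expansion shows that the other terms cancel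
      it.\<close>
    have "{- b..- a} = insert (- b) {1 - b..- a}"
      using True by auto
    then have "sum t {- b..- a} = t (- b) + sum t {1 - b..- a}"
      by simp
    also have "sum t {1 - b..- a} = (\<Sum>j<n. t (1 - b + int j))"
      by (rule sum.reindex_bij_witness[of _ "\<lambda>j. 1 - b + int j" "\<lambda>p. nat (p + b - 1)"])
        (auto simp: n_def)
    also have "\<dots> = - ((- 1) ^ nat \<bar>a + b\<bar> *
        (\<Sum>j<n. (- 1) ^ j * h (1 - b + int j) b * e h (b - 1 - int j) a))"
      unfolding sum_distrib_left sum_negf[symmetric]
      unfolding t_def sign by (rule sum.cong) (simp_all add: mult.assoc)
    also have "\<dots> = - ((- 1) ^ nat \<bar>a + b\<bar> * e h b a)"
      using e_first_row_expansion[of h a b] h_one h_zero True by (simp add: n_def)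
    also have "t (- b) = (- 1) ^ nat \<bar>a + b\<bar> * e h b a"
      using h_one[of "- b"] by (simp add: t_def)
    finally show ?thesis
      using True by simp
  qed
  finally show ?thesis
    by (simp add: t_def)
qed

end
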